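(* Let $G$ be a chordal graph. Then $G$ is ideally connected if and only if $G$ is a threshold graph.
   Context: All graphs are finite and simple. A graph is chordal if it has no induced cycle of length larger than three. For distinct vertices $u,v$ of $G$, $\kappa_G(u,v)$ denotes the maximum number of (pairwise distinct) internally disjoint $u$-$v$ paths in $G$ (the edge $uv$, if present, counts as one path). $G$ is ideally connected if $\kappa_G(u,v)=\min\{\deg_G(u),\deg_G(v)\}$ for every pair of distinct vertices $u,v\in V(G)$. A graph $G$ is $(K,I)$-split if $V(G)$ is partitioned into a clique $K$ and an independent set $I$ (either may be empty). A set $U\subseteq V(G)$ has the nested neighborhood property in $G$ if its vertices can be listed as $v_1,\ldots,v_{|U|}$ so that $N_G(v_i)\subseteq N_G(v_{i+1})$ for each $i\in\{1,\ldots,|U|-1\}$, where $N_G(v)$ is the set of neighbors of $v$. $G$ is a threshold graph if it is $(K,I)$-split for some $K,I$ such that $I$ has the nested neighborhood property in $G$. *)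

theory Defs
  imports "Graph_Theory.Vertex_Walk"
begin

text \<open>
  Finite simple graphs are the objects satisfying the locale predicate \<open>graph\<close>: finite, loopless,
  symmetric digraphs without multiple arcs. An undirected edge \<open>uv\<close> is the pair of arcs from \<open>u\<close> to
  \<open>v\<close> and from \<open>v\<close> to \<open>u\<close>, and \<open>u \<rightarrow>\<^bsub>G\<^esub> v\<close> says that \<open>u\<close> and \<open>v\<close> are adjacent. Accordingly every
  edge at \<open>v\<close> contributes exactly one arc with tail \<open>v\<close>, so \<open>out_degree G v\<close> is the degree of \<open>v\<close>.
\<close>

definition neighborhood :: "('a, 'b) pre_digraph \<Rightarrow> 'a \<Rightarrow> 'a set" where
  "neighborhood G v = {w \<in> verts G. v \<rightarrow>\<^bsub>G\<^esub> w}"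

text \<open>
  An induced cycle is given by its vertices in cyclic order, without repeating the first vertex at
  the end; the equivalence says that the edges among them are exactly those of the cycle.
\<close>

definition induced_cycle :: "('a, 'b) pre_digraph \<Rightarrow> 'a list \<Rightarrow> bool" where
  "induced_cycle G c \<longleftrightarrow>
     3 \<le> length c \<and> distinct c \<and> set c \<subseteq> verts G \<and>
     (\<forall>i < length c. \<forall>j < length c.
        c ! i \<rightarrow>\<^bsub>G\<^esub> c ! j \<longleftrightarrow> j = Suc i mod length c \<or> i = Suc j mod length c)"

definition chordal :: "('a, 'b) pre_digraph \<Rightarrow> bool" where
  "chordal G \<longleftrightarrow> \<not> (\<exists>c. induced_cycle G c \<and> 3 < length c)"

definition paths_between :: "('a, 'b) pre_digraph \<Rightarrow> 'a \<Rightarrow> 'a \<Rightarrow> 'a list set" where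
  "paths_between G u v = {p. vpath p G \<and> hd p = u \<and> last p = v}"

definition internally_disjoint :: "'a \<Rightarrow> 'a \<Rightarrow> 'a list set \<Rightarrow> bool" where
  "internally_disjoint u v P \<longleftrightarrow>
     (\<forall>p \<in> P. \<forall>q \<in> P. p \<noteq> q \<longrightarrow> set p \<inter> set q \<subseteq> {u, v})"

text \<open>
  For a finite graph there are only finitely many paths, and the empty family is admissible, so the
  maximum below is over a finite nonempty set. As paths are vertex lists from \<open>u\<close> to \<open>v\<close> and the
  families are sets, the edge \<open>uv\<close> counts once.
\<close>

definition local_connectivity :: "('a, 'b) pre_digraph \<Rightarrow> 'a \<Rightarrow> 'a \<Rightarrow> nat" where
  "local_connectivity G u v =
     Max {card P | P. P \<subseteq> paths_between G u v \<and> internally_disjoint u v P}"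

definition ideally_connected :: "('a, 'b) pre_digraph \<Rightarrow> bool" where
  "ideally_connected G \<longleftrightarrow>
     (\<forall>u \<in> verts G. \<forall>v \<in> verts G. u \<noteq> v \<longrightarrow>
        local_connectivity G u v = min (out_degree G u) (out_degree G v))"

definition clique :: "('a, 'b) pre_digraph \<Rightarrow> 'a set \<Rightarrow> bool" where
  "clique G K \<longleftrightarrow> K \<subseteq> verts G \<and> (\<forall>u \<in> K. \<forall>v \<in> K. u \<noteq> v \<longrightarrow> u \<rightarrow>\<^bsub>G\<^esub> v)"

definition independent_set :: "('a, 'b) pre_digraph \<Rightarrow> 'a set \<Rightarrow> bool" where
  "independent_set G I \<longleftrightarrow> I \<subseteq> verts G \<and> (\<forall>u \<in> I. \<forall>v \<in> I. \<not> u \<rightarrow>\<^bsub>G\<^esub> v)"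

definition split_graph :: "('a, 'b) pre_digraph \<Rightarrow> 'a set \<Rightarrow> 'a set \<Rightarrow> bool" where
  "split_graph G K I \<longleftrightarrow>
     K \<union> I = verts G \<and> K \<inter> I = {} \<and> clique G K \<and> independent_set G I"

definition nested_neighborhoods :: "('a, 'b) pre_digraph \<Rightarrow> 'a set \<Rightarrow> bool" where
  "nested_neighborhoods G U \<longleftrightarrow>
     (\<exists>vs. distinct vs \<and> set vs = U \<and>
        (\<forall>i. Suc i < length vs \<longrightarrow> neighborhood G (vs ! i) \<subseteq> neighborhood G (vs ! Suc i)))"

definition threshold_graph :: "('a, 'b) pre_digraph \<Rightarrow> bool" where
  "threshold_graph G \<longleftrightarrow> (\<exists>K I. split_graph G K I \<and> nested_neighborhoods G I)"

end

theory Submission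
  imports Defs
begin

text \<open>
  Both conditions say that the vicinal preorder \<open>N(u) - {v} \<subseteq> N(v)\<close> compares any two vertices, the
  one of smaller degree lying below the other. If \<open>u\<close> lies below \<open>v\<close>, the paths \<open>u w v\<close> through the
  neighbours \<open>w\<close> of \<open>u\<close> show that \<open>\<kappa>(u,v) = deg u\<close>. Conversely, a family of \<open>deg u\<close> internally
  disjoint paths uses every neighbour \<open>a\<close> of \<open>u\<close> exactly once, so that \<open>a\<close> can be joined to \<open>v\<close>
  outside the other neighbours of \<open>u\<close>. If \<open>u\<close> and \<open>v\<close> are adjacent, a shortest such connection would
  close to a long induced cycle through \<open>u\<close> unless \<open>a\<close> is adjacent to \<open>v\<close>. If \<open>u\<close> and \<open>v\<close> are not
  adjacent, adjacency to \<open>a\<close> propagates along the connection, because an induced path on four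
  vertices would have incomparable adjacent middle vertices. Given comparability, the vertices with
  a neighbour of no larger degree form the clique of a split partition.
\<close>

text \<open>Removing \<open>v\<close> is what allows adjacent vertices to be comparable, as
  \<open>v\<close> is never its own neighbour.\<close>

definition vicinal_le :: "('a, 'b) pre_digraph \<Rightarrow> 'a \<Rightarrow> 'a \<Rightarrow> bool" where
  "vicinal_le G u v \<longleftrightarrow> neighborhood G u - {v} \<subseteq> neighborhood G v"

section \<open>Walks and paths as vertex lists\<close>

lemma set_vwalk_arcs_subset_iff:
  "set (vwalk_arcs p) \<subseteq> R \<longleftrightarrow> successively (\<lambda>x y. (x, y) \<in> R) p"
  by (induction p rule: vwalk_arcs.induct) auto

lemma vwalk_conv_successively:
  "vwalk p G \<longleftrightarrow> p \<noteq> [] \<and> set p \<subseteq> verts G \<and> successively (\<lambda>x y. x \<rightarrow>\<^bsub>G\<^esub> y) p"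
  by (auto simp: vwalk_def set_vwalk_arcs_subset_iff)

text \<open>Both pieces are contiguous parts of \<open>p\<close>, so the chord is the only new step.
  This shortens a path that has a chord.\<close>

lemma vwalk_shortcut:
  assumes "vwalk p G" "i < j" "j < length p" "p ! i \<rightarrow>\<^bsub>G\<^esub> p ! j"
  shows "vwalk (take (Suc i) p @ drop j p) G"
proof -
  have "successively (\<lambda>x y. x \<rightarrow>\<^bsub>G\<^esub> y) (take (Suc i) p @ drop (Suc i) p)"
    using assms by (simp add: vwalk_conv_successively)
  then have 1: "successively (\<lambda>x y. x \<rightarrow>\<^bsub>G\<^esub> y) (take (Suc i) p)"
    by (simp only: successively_append_iff)
  have "successively (\<lambda>x y. x \<rightarrow>\<^bsub>G\<^esub> y) (take j p @ drop j p)"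
    using assms by (simp add: vwalk_conv_successively)
  then have 2: "successively (\<lambda>x y. x \<rightarrow>\<^bsub>G\<^esub> y) (drop j p)"
    by (simp only: successively_append_iff)
  have "last (take (Suc i) p) = p ! i" "hd (drop j p) = p ! j"
    using assms by (simp_all add: take_Suc_conv_app_nth hd_drop_conv_nth)
  then have "successively (\<lambda>x y. x \<rightarrow>\<^bsub>G\<^esub> y) (take (Suc i) p @ drop j p)"
    using 1 2 assms by (simp add: successively_append_iff)
  then show ?thesis
    using assms by (auto simp: vwalk_conv_successively dest: in_set_takeD in_set_dropD)
qed

lemma distinct_take_append_drop:
  assumes "distinct p" "i \<le> j"
  shows "distinct (take i p @ drop j p)"
  using assms set_take_disj_set_drop_if_distinct[of p i j] by simp

text \<open>Index arithmetic for a cycle obtained by prepending a vertex to a list of length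
  \<open>n\<close>: wrapping around yields 0, the position of the new vertex, which is never of the
  form \<open>Suc j\<close>.\<close>

lemma Suc_eq_Suc_Suc_mod_iff:
  assumes "i < n" "j < n"
  shows "Suc j = Suc (Suc i) mod Suc n \<longleftrightarrow> j = Suc i"
  using assms by (cases "Suc i = n") auto

lemma vpath_Cons_Cons:
  assumes "p \<in> paths_between G u v" "u \<noteq> v"
  obtains x xs where "p = u # x # xs" "vpath (x # xs) G" "u \<rightarrow>\<^bsub>G\<^esub> x" "last (x # xs) = v"
    "u \<notin> set (x # xs)"
proof -
  from assms have p: "vpath p G" "hd p = u" "last p = v"
    by (auto simp: paths_between_def)
  \<comment> \<open>\<open>remdups_adj.cases\<close> serves only as a split into lists with no, one,
    or at least two entries.\<close>
  then obtain x xs where "p = u # x # xs"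
    using assms(2) by (cases p rule: remdups_adj.cases) (auto simp: vpath_def vwalk_def)
  with p that show thesis
    by (auto simp: vpath_def vwalk_def)
qed

context graph
begin

section \<open>Adjacency and degree in a simple graph\<close>

lemma adj_sym: "u \<rightarrow>\<^bsub>G\<^esub> v \<Longrightarrow> v \<rightarrow>\<^bsub>G\<^esub> u"
  using sym_arcs by (rule arcs_ends_symmetric)

lemma adj_neq: "u \<rightarrow>\<^bsub>G\<^esub> v \<Longrightarrow> u \<noteq> v"
  using no_loops by (auto simp: arcs_ends_conv)

lemma mem_neighborhood_iff: "w \<in> neighborhood G v \<longleftrightarrow> v \<rightarrow>\<^bsub>G\<^esub> w"
  by (auto simp: neighborhood_def adj_in_verts)

lemma vicinal_leD: "vicinal_le G u v \<Longrightarrow> u \<rightarrow>\<^bsub>G\<^esub> w \<Longrightarrow> w \<noteq> v \<Longrightarrow> v \<rightarrow>\<^bsub>G\<^esub> w"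
  by (auto simp: vicinal_le_def mem_neighborhood_iff)

lemma finite_neighborhood: "finite (neighborhood G v)"
  by (simp add: neighborhood_def)

lemma out_degree_eq_card_neighborhood: "out_degree G v = card (neighborhood G v)"
proof -
  have "neighborhood G v = head G ` out_arcs G v"
    by (auto simp: mem_neighborhood_iff arcs_ends_conv out_arcs_def)
  moreover have "inj_on (head G) (out_arcs G v)"
    by (rule inj_onI) (auto simp: out_arcs_def arc_to_ends_def intro: no_multi_arcs)
  ultimately show ?thesis
    by (simp add: out_degree_def card_image)
qed

section \<open>Internally disjoint paths and local connectivity\<close>

text \<open>Two paths with a common second vertex meet outside \<open>u\<close>, hence coincide
  unless that vertex is \<open>v\<close>; and then both are \<open>[u, v]\<close>.\<close>

lemma second_vertex_inj:
  assumes "u \<noteq> v" "P \<subseteq> paths_between G u v" "internally_disjoint u v P"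
  shows "inj_on (\<lambda>p. p ! 1) P" "(\<lambda>p. p ! 1) ` P \<subseteq> neighborhood G u"
proof -
  have *: "p = [u, v]" if "p \<in> P" "p ! 1 = v" for p
  proof -
    from that assms(2) have "p \<in> paths_between G u v" by blast
    then obtain x xs where "p = u # x # xs" "vpath (x # xs) G" "last (x # xs) = v"
      using assms(1) by (rule vpath_Cons_Cons)
    with that show ?thesis
      by (cases xs) (auto simp: vpath_def split: if_splits)
  qed
  show "inj_on (\<lambda>p. p ! 1) P"
  proof (rule inj_onI, rule ccontr)
    fix p q assume pq: "p \<in> P" "q \<in> P" "p ! 1 = q ! 1" "p \<noteq> q"
    then have "p \<in> paths_between G u v" "q \<in> paths_between G u v"
      using assms(2) by auto
    then obtain x xs y ys where x: "p = u # x # xs" "u \<notin> set (x # xs)" and y: "q = u # y # ys"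
      using assms(1) by (elim vpath_Cons_Cons)
    have "x \<in> set p \<inter> set q" "x \<noteq> u"
      using x y pq by auto
    then have "x = v"
      using assms(3) pq by (auto simp: internally_disjoint_def)
    then show False
      using *[OF pq(1)] *[OF pq(2)] pq(3,4) x(1) y by simp
  qed
  show "(\<lambda>p. p ! 1) ` P \<subseteq> neighborhood G u"
  proof
    fix a assume "a \<in> (\<lambda>p. p ! 1) ` P"
    then obtain p where p: "p \<in> P" "a = p ! 1" by blast
    with assms(2) have "p \<in> paths_between G u v" by blast
    then obtain x xs where "p = u # x # xs" "u \<rightarrow>\<^bsub>G\<^esub> x"
      using assms(1) by (rule vpath_Cons_Cons)
    with p show "a \<in> neighborhood G u"
      by (simp add: mem_neighborhood_iff)
  qed
qed

lemma card_disjoint_paths_le: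
  assumes "u \<noteq> v" "P \<subseteq> paths_between G u v" "internally_disjoint u v P"
  shows "card P \<le> out_degree G u"
  using card_inj_on_le[OF second_vertex_inj[OF assms] finite_neighborhood]
  by (simp add: out_degree_eq_card_neighborhood)

lemma rev_paths_between:
  assumes "p \<in> paths_between G u v"
  shows "rev p \<in> paths_between G v u"
proof -
  have "successively (\<lambda>x y. x \<rightarrow>\<^bsub>G\<^esub> y) p \<Longrightarrow> successively (\<lambda>x y. y \<rightarrow>\<^bsub>G\<^esub> x) p"
    by (erule successively_mono) (auto intro: adj_sym)
  with assms show ?thesis
    by (auto simp: paths_between_def vpath_def vwalk_conv_successively hd_rev last_rev)
qed

text \<open>The degree bound makes \<open>Max\<close> meaningful without counting paths.\<close>

lemma finite_local_connectivity_candidates: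
  assumes "u \<noteq> v"
  shows "finite {card P | P. P \<subseteq> paths_between G u v \<and> internally_disjoint u v P}"
  by (rule finite_subset[of _ "{..out_degree G u}"]) (auto intro: card_disjoint_paths_le[OF assms])

lemma le_local_connectivity:
  assumes "u \<noteq> v" "P \<subseteq> paths_between G u v" "internally_disjoint u v P"
  shows "card P \<le> local_connectivity G u v"
  unfolding local_connectivity_def
  by (rule Max_ge[OF finite_local_connectivity_candidates[OF assms(1)]]) (use assms in blast)

lemma local_connectivity_attained:
  assumes "u \<noteq> v"
  obtains P where "P \<subseteq> paths_between G u v" "internally_disjoint u v P"
    "card P = local_connectivity G u v"
proof -
  have "card {} \<in> {card P | P. P \<subseteq> paths_between G u v \<and> internally_disjoint u v P}"
    by (rule CollectI, rule exI[of _ "{}"]) (simp add: internally_disjoint_def)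
  then have "local_connectivity G u v
      \<in> {card P | P. P \<subseteq> paths_between G u v \<and> internally_disjoint u v P}"
    unfolding local_connectivity_def
    by (intro Max_in finite_local_connectivity_candidates[OF assms]) blast
  with that show thesis by auto
qed

lemma local_connectivity_le_out_degree:
  "u \<noteq> v \<Longrightarrow> local_connectivity G u v \<le> out_degree G u"
  by (metis local_connectivity_attained card_disjoint_paths_le)

text \<open>Reversing all paths preserves disjointness and cardinality. This transfers the degree
  bound to the other endpoint.\<close>

lemma local_connectivity_commute_le:
  assumes "u \<noteq> v"
  shows "local_connectivity G u v \<le> local_connectivity G v u"
proof -
  obtain P where P: "P \<subseteq> paths_between G u v" "internally_disjoint u v P"
    "card P = local_connectivity G u v"
    using local_connectivity_attained[OF assms] .
  have "rev ` P \<subseteq> paths_between G v u"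
    using P(1) rev_paths_between by blast
  moreover have "internally_disjoint v u (rev ` P)"
    using P(2) by (auto simp: internally_disjoint_def insert_commute)
  moreover have "card (rev ` P) = card P"
    by (rule card_image) simp
  ultimately show ?thesis
    using le_local_connectivity[of v u "rev ` P"] P(3) assms by simp
qed

lemma local_connectivity_commute:
  "u \<noteq> v \<Longrightarrow> local_connectivity G u v = local_connectivity G v u"
  by (intro antisym local_connectivity_commute_le) auto

lemma local_connectivity_vicinal_le:
  assumes "u \<noteq> v" "vicinal_le G u v"
  shows "local_connectivity G u v = out_degree G u"
proof (rule antisym[OF local_connectivity_le_out_degree[OF assms(1)]])
  \<comment> \<open>The neighbour \<open>w = v\<close> is treated apart, since
    \<open>[u, v, v]\<close> is not a path; it contributes the edge.\<close>
  let ?f = "\<lambda>w. if w = v then [u, v] else [u, w, v]"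
  have "?f ` neighborhood G u \<subseteq> paths_between G u v"
  proof
    fix p assume "p \<in> ?f ` neighborhood G u"
    then obtain w where w: "u \<rightarrow>\<^bsub>G\<^esub> w" "p = ?f w"
      by (auto simp: mem_neighborhood_iff)
    moreover have "w \<rightarrow>\<^bsub>G\<^esub> v" if "w \<noteq> v"
      using adj_sym[OF vicinal_leD[OF assms(2) w(1) that]] .
    ultimately show "p \<in> paths_between G u v"
      using assms(1) adj_neq
      by (auto simp: paths_between_def vpath_def vwalk_def intro: adj_in_verts)
  qed
  moreover have "internally_disjoint u v (?f ` neighborhood G u)"
    by (auto simp: internally_disjoint_def)
  moreover have "card (?f ` neighborhood G u) = out_degree G u"
    unfolding out_degree_eq_card_neighborhood
    by (rule card_image) (auto simp: inj_on_def)
  ultimately show "out_degree G u \<le> local_connectivity G u v"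
    using le_local_connectivity[OF assms(1)] by metis
qed

lemma path_avoiding_neighborhood:
  assumes "u \<noteq> v" "local_connectivity G u v = out_degree G u" "u \<rightarrow>\<^bsub>G\<^esub> a"
  obtains p where "vpath p G" "hd p = a" "last p = v" "u \<notin> set p"
    "\<And>w. w \<in> set p \<Longrightarrow> u \<rightarrow>\<^bsub>G\<^esub> w \<Longrightarrow> w = a \<or> w = v"
proof -
  obtain P where P: "P \<subseteq> paths_between G u v" "internally_disjoint u v P"
    "card P = out_degree G u"
    using local_connectivity_attained[OF assms(1)] assms(2) by metis
  \<comment> \<open>An injection into a finite set of the same cardinality is onto, so every
    neighbour of \<open>u\<close> starts some path of \<open>P\<close>.\<close>
  have onto: "(\<lambda>p. p ! 1) ` P = neighborhood G u"
    using second_vertex_inj[OF assms(1) P(1,2)] P(3)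
    by (intro card_subset_eq finite_neighborhood)
      (auto simp: card_image out_degree_eq_card_neighborhood)
  then obtain q where q: "q \<in> P" "q ! 1 = a"
    using assms(3) by (metis mem_neighborhood_iff imageE)
  obtain b xs where "q = u # b # xs" "vpath (b # xs) G" "u \<rightarrow>\<^bsub>G\<^esub> b" "last (b # xs) = v"
      "u \<notin> set (b # xs)"
    using vpath_Cons_Cons[OF subsetD[OF P(1) q(1)] assms(1)] .
  with q(2) have xs: "q = u # a # xs" "vpath (a # xs) G" "last (a # xs) = v" "u \<notin> set (a # xs)"
    by auto
  show thesis
  proof (rule that[of "a # xs"])
    fix w assume w: "w \<in> set (a # xs)" "u \<rightarrow>\<^bsub>G\<^esub> w"
    \<comment> \<open>The path \<open>r\<close> that leaves \<open>u\<close> through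
      \<open>w\<close> also meets \<open>q\<close> in \<open>w\<close>, so disjointness leaves only
      \<open>r = q\<close> or \<open>w = v\<close>.\<close>
    then obtain r where r: "r \<in> P" "r ! 1 = w"
      using onto by (metis mem_neighborhood_iff imageE)
    obtain y ys where "r = u # y # ys"
      using vpath_Cons_Cons[OF subsetD[OF P(1) r(1)] assms(1)] .
    then have "w \<in> set r"
      using r(2) by simp
    moreover have "w \<in> set q" "w \<noteq> u"
      using w xs by auto
    ultimately have "r = q \<or> w = v"
      using P(2) r q by (auto simp: internally_disjoint_def)
    then show "w = a \<or> w = v"
      using r q by auto
  qed (use xs in auto)
qed

section \<open>Induced cycles and chordality\<close>

lemma induced_cycle_Cons:
  assumes p: "vpath p G" "3 \<le> length p" and u: "u \<in> verts G" "u \<notin> set p"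
    and apex: "\<And>i. i < length p \<Longrightarrow> u \<rightarrow>\<^bsub>G\<^esub> p ! i \<longleftrightarrow> i = 0 \<or> Suc i = length p"
    and chordless: "\<And>i j. i < j \<Longrightarrow> j < length p \<Longrightarrow> p ! i \<rightarrow>\<^bsub>G\<^esub> p ! j \<Longrightarrow> j = Suc i"
  shows "induced_cycle G (u # p)"
proof -
  let ?n = "length p"
  have step: "p ! i \<rightarrow>\<^bsub>G\<^esub> p ! Suc i" if "Suc i < ?n" for i
    using p(1) that by (auto simp: vpath_def vwalk_conv_successively successively_conv_nth)
  \<comment> \<open>\<open>chordless\<close> covers \<open>i < j\<close>; symmetry and the absence
    of loops give the remaining pairs.\<close>
  have inner: "p ! i \<rightarrow>\<^bsub>G\<^esub> p ! j \<longleftrightarrow> j = Suc i \<or> i = Suc j" if "i < ?n" "j < ?n" for i j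
    using chordless[of i j] chordless[of j i] step[of i] step[of j] that
    by (metis adj_neq adj_sym linorder_neqE_nat)
  have "(u # p) ! i \<rightarrow>\<^bsub>G\<^esub> (u # p) ! j \<longleftrightarrow>
      j = Suc i mod length (u # p) \<or> i = Suc j mod length (u # p)"
    if "i < length (u # p)" "j < length (u # p)" for i j
  proof (cases i; cases j)
    assume "i = 0" "j = 0"
    then show ?thesis using adj_neq p(2) by auto
  next
    fix j' assume "i = 0" "j = Suc j'"
    moreover from this have "j = Suc i mod length (u # p) \<or> i = Suc j mod length (u # p)
        \<longleftrightarrow> j' = 0 \<or> Suc j' = ?n"
      using that p(2) by (cases "Suc j' = ?n") auto
    ultimately show ?thesis using apex[of j'] that by simp
  next
    fix i' assume "i = Suc i'" "j = 0"
    moreover from this have "j = Suc i mod length (u # p) \<or> i = Suc j mod length (u # p)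
        \<longleftrightarrow> i' = 0 \<or> Suc i' = ?n"
      using that p(2) by (cases "Suc i' = ?n") auto
    ultimately show ?thesis
      using apex[of i'] adj_sym[of u "p ! i'"] adj_sym[of "p ! i'" u] that by auto
  next
    fix i' j' assume "i = Suc i'" "j = Suc j'"
    then show ?thesis
      using inner[of i' j'] Suc_eq_Suc_Suc_mod_iff[of i' ?n j'] Suc_eq_Suc_Suc_mod_iff[of j' ?n i'] that
      by simp
  qed
  then show ?thesis
    using p u by (auto simp: induced_cycle_def vpath_def vwalk_def)
qed

lemma chordal_apex:
  assumes "chordal G" "u \<rightarrow>\<^bsub>G\<^esub> a" "u \<rightarrow>\<^bsub>G\<^esub> v" "a \<noteq> v"
    and p: "vpath p G" "hd p = a" "last p = v" "u \<notin> set p"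
      "\<And>w. w \<in> set p \<Longrightarrow> u \<rightarrow>\<^bsub>G\<^esub> w \<Longrightarrow> w = a \<or> w = v"
  shows "a \<rightarrow>\<^bsub>G\<^esub> v"
proof (rule ccontr)
  assume nadj: "\<not> a \<rightarrow>\<^bsub>G\<^esub> v"
  \<comment> \<open>Competitors for a shortest path stay inside \<open>set p\<close>, so
    \<open>u\<close> is adjacent to none of their vertices except \<open>a\<close> and
    \<open>v\<close>.\<close>
  define Q where "Q q \<longleftrightarrow> vpath q G \<and> hd q = a \<and> last q = v \<and> set q \<subseteq> set p" for q
  have "Q p"
    using p by (simp add: Q_def)
  then obtain q where q: "Q q" and min: "\<And>r. Q r \<Longrightarrow> length q \<le> length r"
    using exists_least_iff[of "\<lambda>n. \<exists>q. Q q \<and> length q = n"] by (metis not_le)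
  have ne: "q \<noteq> []" and dist: "distinct q"
    using q by (auto simp: Q_def vpath_def vwalk_def)
  have first: "q ! 0 = a" and last: "q ! (length q - 1) = v"
    using q ne by (auto simp: Q_def hd_conv_nth last_conv_nth)
  \<comment> \<open>This gives \<open>u # q\<close> at least four vertices, the length that
    chordality forbids.\<close>
  have len: "3 \<le> length q"
  proof (rule ccontr)
    assume "\<not> 3 \<le> length q"
    then have "length q = 1 \<or> length q = 2"
      using ne by (cases "length q") (auto simp: less_Suc_eq_le not_le)
    then show False
    proof
      assume "length q = 1"
      then show False using first last assms(4) by simp
    next
      assume "length q = 2"
      then show False using first last nadj q
        by (auto simp: Q_def vpath_def vwalk_conv_successively successively_conv_nth)
    qed
  qed
  have "induced_cycle G (u # q)"
  proof (rule induced_cycle_Cons[OF _ len])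
    show "vpath q G" "u \<notin> set q"
      using q p(4) by (auto simp: Q_def)
    show "u \<in> verts G"
      using assms(2) by (rule adj_in_verts)
    fix i assume i: "i < length q"
    then have "q ! i \<in> set p"
      using q unfolding Q_def by (meson nth_mem subsetD)
    then have "u \<rightarrow>\<^bsub>G\<^esub> q ! i \<longleftrightarrow> q ! i = q ! 0 \<or> q ! i = q ! (length q - 1)"
      using p(5)[of "q ! i"] assms(2,3) first last by auto
    then show "u \<rightarrow>\<^bsub>G\<^esub> q ! i \<longleftrightarrow> i = 0 \<or> Suc i = length q"
      using i ne dist by (auto simp: nth_eq_iff_index_eq)
  next
    fix i j assume ij: "i < j" "j < length q" "q ! i \<rightarrow>\<^bsub>G\<^esub> q ! j"
    \<comment> \<open>Cutting out the positions strictly between \<open>i\<close> and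
      \<open>j\<close> leaves a competitor, so minimality of \<open>q\<close> forces
      \<open>j \<le> Suc i\<close>.\<close>
    let ?r = "take (Suc i) q @ drop j q"
    have "vwalk ?r G"
      using q ij by (intro vwalk_shortcut) (auto simp: Q_def vpath_def)
    moreover have "distinct ?r"
      using dist ij by (intro distinct_take_append_drop) auto
    moreover have "hd ?r = a" "last ?r = v"
      using q ij ne by (auto simp: Q_def)
    moreover have "set ?r \<subseteq> set p"
      using q by (auto simp: Q_def dest: in_set_takeD in_set_dropD)
    ultimately have "Q ?r"
      by (auto simp: Q_def)
    from min[OF this] show "j = Suc i"
      using ij by auto
  qed
  then show False
    using assms(1) len by (auto simp: chordal_def)
qed

section \<open>From ideal connectedness to comparability\<close>

lemma ideally_connected_local:
  assumes "ideally_connected G" "u \<in> verts G" "v \<in> verts G" "u \<noteq> v"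
    "out_degree G u \<le> out_degree G v"
  shows "local_connectivity G u v = out_degree G u"
  using assms by (simp add: ideally_connected_def)

text \<open>Here \<open>u\<close> is adjacent to both ends of the connection from \<open>a\<close>
  to \<open>v\<close> and to nothing else on it, so \<open>chordal_apex\<close> applies.\<close>

lemma vicinal_le_if_adj:
  assumes "chordal G" "ideally_connected G" "u \<rightarrow>\<^bsub>G\<^esub> v" "out_degree G u \<le> out_degree G v"
  shows "vicinal_le G u v"
  unfolding vicinal_le_def
proof
  fix a assume "a \<in> neighborhood G u - {v}"
  then have a: "u \<rightarrow>\<^bsub>G\<^esub> a" "a \<noteq> v"
    by (auto simp: mem_neighborhood_iff)
  have "u \<noteq> v" and "local_connectivity G u v = out_degree G u"
    using assms adj_neq by (auto intro: ideally_connected_local adj_in_verts)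
  from path_avoiding_neighborhood[OF this a(1)] chordal_apex[OF assms(1) a(1) assms(3) a(2)]
  have "a \<rightarrow>\<^bsub>G\<^esub> v" by metis
  then show "a \<in> neighborhood G v"
    by (simp add: mem_neighborhood_iff adj_sym)
qed

text \<open>No cycle closes through \<open>u\<close> here. Instead the adjacent case is applied to
  \<open>a\<close> and the vertices of the connection, one after another.\<close>

lemma vicinal_le_if_not_adj:
  assumes "chordal G" "ideally_connected G" "u \<in> verts G" "v \<in> verts G" "u \<noteq> v"
    "\<not> u \<rightarrow>\<^bsub>G\<^esub> v" "out_degree G u \<le> out_degree G v"
  shows "vicinal_le G u v"
  unfolding vicinal_le_def
proof
  fix a assume "a \<in> neighborhood G u - {v}"
  then have a: "u \<rightarrow>\<^bsub>G\<^esub> a" "a \<noteq> v"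
    by (auto simp: mem_neighborhood_iff)
  obtain p where p: "vpath p G" "hd p = a" "last p = v" "u \<notin> set p"
    "\<And>w. w \<in> set p \<Longrightarrow> u \<rightarrow>\<^bsub>G\<^esub> w \<Longrightarrow> w = a \<or> w = v"
    using path_avoiding_neighborhood[OF assms(5) ideally_connected_local a(1)] assms by metis
  have ne: "p \<noteq> []"
    using p(1) by (auto simp: vpath_def vwalk_def)
  have "p ! i = a \<or> a \<rightarrow>\<^bsub>G\<^esub> p ! i" if "i < length p" for i
    using that
  proof (induction i)
    case 0
    then show ?case using p(2) ne by (simp add: hd_conv_nth)
  next
    case (Suc i)
    have xy: "p ! i \<rightarrow>\<^bsub>G\<^esub> p ! Suc i"
      using p(1) Suc.prems by (auto simp: vpath_def vwalk_conv_successively successively_conv_nth)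
    show ?case
    proof (cases "p ! i = a")
      case True
      then show ?thesis using xy by simp
    next
      case False
      then have ax: "a \<rightarrow>\<^bsub>G\<^esub> p ! i" using Suc by auto
      have "p ! i \<in> set p" using Suc.prems by auto
      \<comment> \<open>The only neighbour of \<open>u\<close> on \<open>p\<close> is
        \<open>a\<close>, since \<open>v\<close> is not adjacent to \<open>u\<close>. Thus
        \<open>u\<close> is a neighbour of \<open>a\<close> that keeps \<open>a\<close> from lying
        below \<open>p ! i\<close>.\<close>
      then have "\<not> p ! i \<rightarrow>\<^bsub>G\<^esub> u" "p ! i \<noteq> u"
        using p(4,5) False assms(6) adj_sym by metis+
      then have "\<not> vicinal_le G a (p ! i)"
        using adj_sym[OF a(1)] by (auto simp: vicinal_le_def mem_neighborhood_iff)
      \<comment> \<open>Adjacent vertices are comparable, whichever degree is smaller, and one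
        direction has just been excluded.\<close>
      then have "vicinal_le G (p ! i) a"
        using vicinal_le_if_adj[OF assms(1,2)] ax adj_sym nle_le by metis
      then show ?thesis
        using xy by (auto simp: vicinal_le_def mem_neighborhood_iff)
    qed
  qed
  from this[of "length p - 1"] have "a \<rightarrow>\<^bsub>G\<^esub> v"
    using ne p(3) a(2) by (auto simp: last_conv_nth)
  then show "a \<in> neighborhood G v"
    by (simp add: mem_neighborhood_iff adj_sym)
qed

section \<open>From comparability to a threshold partition\<close>

lemma threshold_graph_if_vicinal_le:
  assumes vle: "\<And>u v. u \<in> verts G \<Longrightarrow> v \<in> verts G \<Longrightarrow> u \<noteq> v \<Longrightarrow>
    out_degree G u \<le> out_degree G v \<Longrightarrow> vicinal_le G u v"
  shows "threshold_graph G"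
proof -
  let ?d = "out_degree G"
  define K where "K = {v \<in> verts G. \<exists>u. u \<rightarrow>\<^bsub>G\<^esub> v \<and> ?d u \<le> ?d v}"
  define I where "I = verts G - K"
  \<comment> \<open>A witness \<open>u\<close> for \<open>v \<in> K\<close> satisfies
    \<open>?d u \<le> ?d v \<le> ?d w\<close>; so either \<open>u = w\<close>, or \<open>u\<close>
    lies below \<open>w\<close> and passes its neighbour \<open>v\<close> on to
    \<open>w\<close>.\<close>
  have adj: "v \<rightarrow>\<^bsub>G\<^esub> w" if "v \<in> K" "w \<in> K" "v \<noteq> w" "?d v \<le> ?d w" for v w
  proof -
    from that obtain u where u: "u \<rightarrow>\<^bsub>G\<^esub> v" "?d u \<le> ?d v"
      by (auto simp: K_def)
    show ?thesis
    proof (cases "u = w")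
      case True
      then show ?thesis using u adj_sym by auto
    next
      case False
      then have "vicinal_le G u w"
        using u that by (intro vle) (auto simp: K_def intro: adj_in_verts)
      then show ?thesis
        using adj_sym[OF vicinal_leD[OF _ u(1) that(3)]] by blast
    qed
  qed
  have "clique G K"
    unfolding clique_def using adj adj_sym nle_le
    by (metis (mono_tags, lifting) K_def mem_Collect_eq subsetI)
  moreover have "independent_set G I"
    unfolding independent_set_def
  proof (intro conjI ballI notI)
    \<comment> \<open>On any edge, an endpoint of maximal degree belongs to
      \<open>K\<close>.\<close>
    fix u v assume "u \<in> I" "v \<in> I" "u \<rightarrow>\<^bsub>G\<^esub> v"
    then have "\<not> ?d u \<le> ?d v" "\<not> ?d v \<le> ?d u"
      using adj_sym by (auto simp: I_def K_def)
    then show False by simp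
  qed (auto simp: I_def)
  ultimately have "split_graph G K I"
    by (auto simp: split_graph_def I_def K_def)
  moreover have "nested_neighborhoods G I"
  proof -
    obtain xs where xs: "set xs = I" "distinct xs"
      using finite_distinct_list[of I] by (auto simp: I_def)
    \<comment> \<open>Listing \<open>I\<close> by increasing degree works: between independent
      vertices the exception in \<open>vicinal_le\<close> is void, leaving plain inclusion.\<close>
    let ?vs = "sort_key ?d xs"
    have vs: "set ?vs = I" "distinct ?vs"
      using xs by auto
    have "neighborhood G (?vs ! i) \<subseteq> neighborhood G (?vs ! Suc i)" if i: "Suc i < length ?vs" for i
    proof -
      let ?u = "?vs ! i" and ?v = "?vs ! Suc i"
      have mem: "?u \<in> I" "?v \<in> I" "?u \<noteq> ?v"
        using vs i nth_mem[of i ?vs] nth_mem[of "Suc i" ?vs] nth_eq_iff_index_eq[of ?vs i "Suc i"]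
        by simp_all
      have "?d ?u \<le> ?d ?v"
        using sorted_nth_mono[OF sorted_sort_key[of ?d xs], of i "Suc i"] i by simp
      then have "vicinal_le G ?u ?v"
        using mem by (intro vle) (auto simp: I_def)
      moreover have "?v \<notin> neighborhood G ?u"
        using mem \<open>independent_set G I\<close> by (auto simp: independent_set_def mem_neighborhood_iff)
      ultimately show ?thesis
        by (auto simp: vicinal_le_def)
    qed
    with vs show ?thesis
      unfolding nested_neighborhoods_def by blast
  qed
  ultimately show ?thesis
    by (auto simp: threshold_graph_def)
qed

section \<open>From threshold graphs back to comparability\<close>

lemma nested_neighborhoods_total:
  assumes "nested_neighborhoods G U" "u \<in> U" "v \<in> U"
  shows "neighborhood G u \<subseteq> neighborhood G v \<or> neighborhood G v \<subseteq> neighborhood G u"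
proof -
  obtain vs where vs: "set vs = U"
    "\<And>i. Suc i < length vs \<Longrightarrow> neighborhood G (vs ! i) \<subseteq> neighborhood G (vs ! Suc i)"
    using assms(1) by (auto simp: nested_neighborhoods_def)
  have mono: "neighborhood G (vs ! i) \<subseteq> neighborhood G (vs ! j)" if "i \<le> j" "j < length vs" for i j
    using that by (induction j rule: dec_induct) (use vs(2) in \<open>auto dest: Suc_lessD\<close>)
  obtain i j where "i < length vs" "vs ! i = u" "j < length vs" "vs ! j = v"
    using assms vs(1) by (metis in_set_conv_nth)
  then show ?thesis
    using mono[of i j] mono[of j i] by (cases "i \<le> j") auto
qed

text \<open>Vertices of \<open>I\<close> have all neighbours in the clique \<open>K\<close> and so
  lie below every vertex of \<open>K\<close>. Nesting settles two vertices of \<open>I\<close> and,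
  indirectly, two of \<open>K\<close>.\<close>

lemma threshold_graph_vicinal_total:
  assumes "threshold_graph G" "u \<in> verts G" "v \<in> verts G"
  shows "vicinal_le G u v \<or> vicinal_le G v u"
proof -
  obtain K I where KI: "K \<union> I = verts G" "clique G K" "independent_set G I"
    and nested: "nested_neighborhoods G I"
    using assms(1) by (auto simp: threshold_graph_def split_graph_def)
  have K: "x \<rightarrow>\<^bsub>G\<^esub> y" if "x \<in> K" "y \<in> K" "x \<noteq> y" for x y
    using KI(2) that by (simp add: clique_def)
  have I: "y \<in> K" if "x \<in> I" "x \<rightarrow>\<^bsub>G\<^esub> y" for x y
    using KI that by (auto simp: independent_set_def dest: adj_in_verts)
  have IK: "vicinal_le G x y" if "x \<in> I" "y \<in> K" for x y
    unfolding vicinal_le_def using K[OF that(2) I[OF that(1)]]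
    by (metis DiffE mem_neighborhood_iff singletonI subsetI)
  consider "u \<in> I" "v \<in> I" | "u \<in> I" "v \<in> K" | "u \<in> K" "v \<in> I" | "u \<in> K" "v \<in> K"
    using assms KI(1) by auto
  then show ?thesis
  proof cases
    case 1
    then show ?thesis
      using nested_neighborhoods_total[OF nested] by (auto simp: vicinal_le_def)
  next
    case 4
    show ?thesis
    proof (rule ccontr)
      assume "\<not> ?thesis"
      then have "\<not> vicinal_le G u v" "\<not> vicinal_le G v u"
        by auto
      then obtain a b where ab: "u \<rightarrow>\<^bsub>G\<^esub> a" "a \<noteq> v" "\<not> v \<rightarrow>\<^bsub>G\<^esub> a"
        "v \<rightarrow>\<^bsub>G\<^esub> b" "b \<noteq> u" "\<not> u \<rightarrow>\<^bsub>G\<^esub> b"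
        unfolding vicinal_le_def by (metis DiffE mem_neighborhood_iff singletonI subsetI)
      \<comment> \<open>In \<open>K\<close>, \<open>a\<close> would be adjacent to \<open>v\<close>
        and \<open>b\<close> to \<open>u\<close>. Now \<open>u\<close> is a neighbour of
        \<open>a\<close> only and \<open>v\<close> of \<open>b\<close> only, against
        nesting.\<close>
      then have "a \<in> I" "b \<in> I"
        using 4 K KI(1) by (metis UnE adj_in_verts(2))+
      from nested_neighborhoods_total[OF nested this] show False
        using ab by (meson adj_sym mem_neighborhood_iff subsetD)
    qed
  qed (use IK in auto)
qed

text \<open>Follows from deg u = \<kappa>(u,v) = \<kappa>(v,u) \<le> deg v, with no separate count
  for adjacent \<open>u\<close> and \<open>v\<close>.\<close>

lemma vicinal_le_out_degree_le:
  assumes "u \<noteq> v" "vicinal_le G u v"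
  shows "out_degree G u \<le> out_degree G v"
  using assms
  by (metis local_connectivity_vicinal_le local_connectivity_commute local_connectivity_le_out_degree)

end

theorem theorem1p2:
  fixes G :: "('a, 'b) pre_digraph"
  assumes "graph G" and "chordal G"
  shows "ideally_connected G \<longleftrightarrow> threshold_graph G"
proof -
  interpret graph G by fact
  show ?thesis
  proof
    assume ideal: "ideally_connected G"
    show "threshold_graph G"
    proof (rule threshold_graph_if_vicinal_le)
      fix u v assume "u \<in> verts G" "v \<in> verts G" "u \<noteq> v" "out_degree G u \<le> out_degree G v"
      then show "vicinal_le G u v"
        using vicinal_le_if_adj[OF assms(2) ideal] vicinal_le_if_not_adj[OF assms(2) ideal]
        by (cases "u \<rightarrow>\<^bsub>G\<^esub> v") auto
    qed
  next
    assume thr: "threshold_graph G"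
    \<comment> \<open>The lower vertex has the smaller degree; if \<open>v\<close> is the lower one,
      symmetry of local connectivity reduces to this case.\<close>
    have *: "local_connectivity G u v = min (out_degree G u) (out_degree G v)"
      if "u \<noteq> v" "vicinal_le G u v" for u v
      using local_connectivity_vicinal_le[OF that] vicinal_le_out_degree_le[OF that] by simp
    show "ideally_connected G"
      unfolding ideally_connected_def
    proof (intro ballI impI)
      fix u v assume uv: "u \<in> verts G" "v \<in> verts G" "u \<noteq> v"
      then show "local_connectivity G u v = min (out_degree G u) (out_degree G v)"
        using threshold_graph_vicinal_total[OF thr] *[of u v] *[of v u]
          local_connectivity_commute[OF uv(3)] by (metis min.commute)
    qed
  qed
qed

end
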